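(* Let $n\ge 1$, let $\lambda\in(0,1)$ and let $f,g:\mathbb{R}^n\to\mathbb{R}_{\ge 0}$ be non-negative measurable functions such that $(1-\lambda) f\star\lambda g$ is measurable. If there exists a hyperplane $H\in\mathcal{L}^n_{n-1}$ such that $$\mathrm{proj}_H(f)=\mathrm{proj}_H(g),$$ then $$\int_{\mathbb{R}^n}(1-\lambda) f\star\lambda g\,\mathrm{d}x \;\geq\; (1-\lambda)\int_{\mathbb{R}^n}f\,\mathrm{d} x +\lambda \int_{\mathbb{R}^n}g\,\mathrm{d} x .$$
   Context: Measurable means Lebesgue measurable; integrals of non-negative functions take values in $[0,\infty]$. $\mathcal{L}^n_{n-1}$ is the set of $(n-1)$-dimensional linear subspaces of $\mathbb{R}^n$ (hyperplanes through the origin). For $f,g:\mathbb{R}^n\to\mathbb{R}_{\ge0}$ and $\lambda\in(0,1)$, the Asplund sum $(1-\lambda) f\star\lambda g:\mathbb{R}^n\to\mathbb{R}_{\geq0}\cup\{\infty\}$ is $$\bigl((1-\lambda) f\star\lambda g\bigr)(x)=\sup_{(1-\lambda) x_1+\lambda x_2=x} f(x_1)^{1-\lambda} g(x_2)^{\lambda}.$$ For $f:\mathbb{R}^n\to\mathbb{R}_{\ge0}\cup\{\infty\}$ and $H\in\mathcal{L}^n_{n-1}$ with unit normal vector $\nu$, the projection of $f$ onto $H$ is the function $\mathrm{proj}_H(f):H\to\mathbb{R}_{\ge0}\cup\{\infty\}$, $\mathrm{proj}_H(f)(h)=\sup_{\alpha\in\mathbb{R}} f(h+\alpha\nu)$.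 *)

theory Defs
  imports "HOL-Analysis.Analysis"
begin

definition asplund_sum ::
    "real \<Rightarrow> (real ^ 'n \<Rightarrow> real) \<Rightarrow> (real ^ 'n \<Rightarrow> real) \<Rightarrow> real ^ 'n \<Rightarrow> ennreal" where
  "asplund_sum t f g x =
     Sup {ennreal (f x1 powr (1 - t) * g x2 powr t) | x1 x2.
            (1 - t) *\<^sub>R x1 + t *\<^sub>R x2 = x}"

definition linear_hyperplanes :: "(real ^ 'n) set set" where
  "linear_hyperplanes = {H. subspace H \<and> dim H = CARD('n) - 1}"

definition is_unit_normal :: "real ^ 'n \<Rightarrow> (real ^ 'n) set \<Rightarrow> bool" where
  "is_unit_normal \<nu> H \<longleftrightarrow> norm \<nu> = 1 \<and> (\<forall>h\<in>H. orthogonal \<nu> h)"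

text \<open>The unit normal of a hyperplane is only determined up to sign; the choice is
  immaterial by \<open>proj_fun_eq\<close> below. The projection is a function with domain \<open>H\<close>,
  hence \<open>restrict\<close>: equality of projections means equality on \<open>H\<close>.\<close>

definition proj_fun ::
    "(real ^ 'n) set \<Rightarrow> (real ^ 'n \<Rightarrow> ennreal) \<Rightarrow> real ^ 'n \<Rightarrow> ennreal" where
  "proj_fun H f =
     restrict (\<lambda>h. SUP \<alpha>::real. f (h + \<alpha> *\<^sub>R (SOME \<nu>. is_unit_normal \<nu> H))) H"

lemma ex_unit_normal:
  fixes H :: "(real ^ 'n) set"
  assumes "H \<in> linear_hyperplanes"
  shows "\<exists>\<nu>. is_unit_normal \<nu> H"
proof -
  have H: "subspace H" "dim H < DIM(real ^ 'n)"
    using assms by (auto simp: linear_hyperplanes_def)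
  obtain a where a: "a \<noteq> 0" "\<And>y. y \<in> span H \<Longrightarrow> orthogonal a y"
    using orthogonal_to_subspace_exists[OF H(2)] by blast
  have "is_unit_normal (a /\<^sub>R norm a) H"
    using a by (auto simp: is_unit_normal_def orthogonal_def span_base)
  then show ?thesis by blast
qed

lemma unit_normal_unique:
  fixes H :: "(real ^ 'n) set"
  assumes "H \<in> linear_hyperplanes" "is_unit_normal \<nu> H" "is_unit_normal \<mu> H"
  shows "\<mu> = \<nu> \<or> \<mu> = - \<nu>"
proof -
  have H: "subspace H" "dim H + 1 = DIM(real ^ 'n)"
    using assms(1) by (auto simp: linear_hyperplanes_def)
  have n: "norm \<nu> = 1" "norm \<mu> = 1" "\<nu> \<noteq> 0"
    using assms by (auto simp: is_unit_normal_def)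
  have sub: "H \<subseteq> {x. \<nu> \<bullet> x = 0}"
    using assms(2) by (auto simp: is_unit_normal_def orthogonal_def)
  have eq: "H = {x. \<nu> \<bullet> x = 0}"
    using subspace_dim_equal[OF H(1) subspace_hyperplane sub] dim_hyperplane[OF n(3)] H(2)
    by simp
  define c where "c = \<nu> \<bullet> \<mu>"
  have "\<nu> \<bullet> \<nu> = 1" using n by (simp add: norm_eq_1)
  then have mem: "\<mu> - c *\<^sub>R \<nu> \<in> H" by (simp add: eq c_def inner_diff_right)
  have "\<mu> \<bullet> (\<mu> - c *\<^sub>R \<nu>) = 0" "\<nu> \<bullet> (\<mu> - c *\<^sub>R \<nu>) = 0"
    using mem assms by (auto simp: is_unit_normal_def orthogonal_def)
  then have "(\<mu> - c *\<^sub>R \<nu>) \<bullet> (\<mu> - c *\<^sub>R \<nu>) = 0"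
    by (simp add: inner_diff_left)
  then have mu: "\<mu> = c *\<^sub>R \<nu>" by simp
  then have "\<bar>c\<bar> = 1" using n by (metis norm_scaleR mult.right_neutral)
  then have "c = 1 \<or> c = - 1" by linarith
  then show ?thesis using mu by auto
qed

lemma proj_fun_eq:
  fixes H :: "(real ^ 'n) set"
  assumes "H \<in> linear_hyperplanes" "is_unit_normal \<nu> H" "h \<in> H"
  shows "proj_fun H f h = (SUP \<alpha>::real. f (h + \<alpha> *\<^sub>R \<nu>))"
proof -
  define \<mu> where "\<mu> = (SOME \<mu>. is_unit_normal \<mu> H)"
  have "is_unit_normal \<mu> H"
    unfolding \<mu>_def using assms(2) by (rule someI)
  then consider "\<mu> = \<nu>" | "\<mu> = - \<nu>"
    using unit_normal_unique[OF assms(1,2)] by blast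
  then have "range (\<lambda>\<alpha>::real. f (h + \<alpha> *\<^sub>R \<mu>)) = range (\<lambda>\<alpha>::real. f (h + \<alpha> *\<^sub>R \<nu>))"
  proof cases
    case 2
    have "range (\<lambda>\<alpha>::real. f (h + \<alpha> *\<^sub>R \<mu>)) = (\<lambda>\<alpha>. f (h + \<alpha> *\<^sub>R \<nu>)) ` range (uminus :: real \<Rightarrow> real)"
      unfolding 2 image_image by simp
    then show ?thesis by (simp add: surj_uminus)
  qed simp
  then show ?thesis
    using assms(3) by (simp add: proj_fun_def \<mu>_def)
qed

end

(* On each line parallel to the unit normal of H the restrictions of f and g have the same supremum,
   so for every s the superlevel sets {f > s} and {g > s} on that line are both empty or both
   non-empty. In the second case (1 - t) {f > s} + t {g > s} lies in the superlevel set of the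
   Asplund sum, and the one-dimensional Brunn-Minkowski inequality, which is linear in the measures,
   compares the measures. Integration over s and then over the lines gives the claim. *)

theory Submission imports Defs
begin

section \<open>Inner regularity and the Brunn-Minkowski inequality on the line\<close>

text \<open>A closed subset exhausts \<open>S\<close> up to measure \<open>e\<close>, and its
  intersections with growing balls exhaust the closed set. The compact sets are kept non-empty
  because a sumset with the empty set carries no information.\<close>

lemma emeasure_lebesgue_inner_compact:
  fixes S :: "'a::euclidean_space set"
  assumes S: "S \<in> sets lebesgue" "S \<noteq> {}"
  shows "emeasure lebesgue S = (SUP T\<in>{T. compact T \<and> T \<noteq> {} \<and> T \<subseteq> S}. emeasure lebesgue T)"
    (is "_ = ?R")
proof (rule antisym)
  show "?R \<le> emeasure lebesgue S"
    using S by (intro SUP_least emeasure_mono) auto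
  obtain a where a: "a \<in> S" using S by auto
  show "emeasure lebesgue S \<le> ?R"
  proof (rule ennreal_le_epsilon)
    fix e :: real assume "0 < e"
    then obtain T where T: "closed T" "T \<subseteq> S" "S - T \<in> lmeasurable"
        "emeasure lebesgue (S - T) < ennreal e"
      using sets_lebesgue_inner_closed S(1) by metis
    have "emeasure lebesgue (T \<inter> cball 0 (real n)) \<le> ?R" for n
    proof -
      \<comment> \<open>The point \<open>a\<close> of \<open>S\<close> makes the compact set
        non-empty even when the ball misses \<open>T\<close>.\<close>
      have "emeasure lebesgue (T \<inter> cball 0 (real n)) 
          \<le> emeasure lebesgue (insert a (T \<inter> cball 0 (real n)))"
        using T by (intro emeasure_mono) (auto intro!: lmeasurable_compact fmeasurableD closed_Int_compact)
      also have "\<dots> \<le> ?R"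
        using T(1,2) a by (intro SUP_upper) (auto intro!: compact_insert closed_Int_compact)
      finally show ?thesis .
    qed
    moreover have "(SUP n. emeasure lebesgue (T \<inter> cball 0 (real n))) 
        = emeasure lebesgue (\<Union>n. T \<inter> cball 0 (real n))"
    proof (rule SUP_emeasure_incseq)
      show "range (\<lambda>n. T \<inter> cball 0 (real n)) \<subseteq> sets lebesgue"
        using T by (auto intro!: lmeasurable_compact fmeasurableD closed_Int_compact)
      show "incseq (\<lambda>n. T \<inter> cball 0 (real n))"
        by (auto simp: incseq_def)
    qed
    moreover have "(\<Union>n. T \<inter> cball 0 (real n)) = T"
      by (auto simp: real_arch_simple)
    ultimately have TR: "emeasure lebesgue T \<le> ?R"
      by (metis (no_types, lifting) SUP_least)
    have "T \<in> sets lebesgue" using T(1) by (simp add: borel_closed)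
    then have "emeasure lebesgue (T \<union> (S - T)) \<le> emeasure lebesgue T + emeasure lebesgue (S - T)"
      using T by (intro emeasure_subadditive) auto
    then have "emeasure lebesgue S \<le> emeasure lebesgue T + emeasure lebesgue (S - T)"
      using T(2) by (simp add: Un_absorb1)
    also have "\<dots> \<le> ?R + ennreal e"
      using TR T(4) by (intro add_mono) auto
    finally show "emeasure lebesgue S \<le> ?R + ennreal e" .
  qed
qed

lemma emeasure_lebesgue_shift:
  fixes S :: "'a::euclidean_space set"
  shows "emeasure lebesgue ((\<lambda>x. x + c) ` S) = emeasure lebesgue S"
  using emeasure_lebesgue_affine[of 1 c S] by (simp add: add.commute)

text \<open>The translates of \<open>A\<close> by \<open>min B\<close> and of \<open>B\<close> by \<open>max A\<close> meet in one point only.\<close>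

lemma emeasure_compact_sumset_ge:
  fixes A B K :: "real set"
  assumes "compact A" "A \<noteq> {}" "compact B" "B \<noteq> {}"
    and K: "K \<in> sets lebesgue" "\<And>a b. a \<in> A \<Longrightarrow> b \<in> B \<Longrightarrow> a + b \<in> K"
  shows "emeasure lebesgue A + emeasure lebesgue B \<le> emeasure lebesgue K"
proof -
  obtain p where p: "p \<in> A" "\<And>a. a \<in> A \<Longrightarrow> a \<le> p"
    using compact_attains_sup[OF assms(1,2)] by auto
  obtain q where q: "q \<in> B" "\<And>b. b \<in> B \<Longrightarrow> q \<le> b"
    using compact_attains_inf[OF assms(3,4)] by auto
  let ?A = "(\<lambda>x. x + q) ` A" and ?B = "(\<lambda>x. x + p) ` B"
  have "compact ?A" "compact ?B"
    using assms by (auto intro!: compact_continuous_image continuous_intros)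
  then have m: "?A \<in> sets lebesgue" "?B \<in> sets lebesgue"
    by (auto intro: lmeasurable_compact fmeasurableD)
  have "?A \<inter> ?B \<subseteq> {p + q}" using p q by force
  then have "emeasure lebesgue (?A \<inter> ?B) \<le> emeasure lebesgue {p + q}"
    by (intro emeasure_mono) auto
  then have "?A \<inter> ?B \<in> null_sets lebesgue"
    using m by (auto intro!: null_setsI)
  then have "emeasure lebesgue (?A \<union> ?B) = emeasure lebesgue ?A + emeasure lebesgue ?B"
    using m by (intro emeasure_Un') auto
  \<comment> \<open>Both translates consist of sums from \<open>A\<close> and \<open>B\<close>,
    because the extreme points \<open>p\<close> and \<open>q\<close> are attained.\<close>
  moreover have "emeasure lebesgue (?A \<union> ?B) \<le> emeasure lebesgue K"
    using K p(1) q(1) by (intro emeasure_mono) (auto, metis add.commute)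
  ultimately show ?thesis by (simp add: emeasure_lebesgue_shift)
qed

text \<open>Approximation by compact sets from inside reduces this to the compact case. The set
  \<open>K\<close> stands in for the sumset, which need not be measurable.\<close>

lemma emeasure_sumset_ge:
  fixes A B K :: "real set"
  assumes A: "A \<in> sets lebesgue" "A \<noteq> {}" and B: "B \<in> sets lebesgue" "B \<noteq> {}"
    and K: "K \<in> sets lebesgue" "\<And>a b. a \<in> A \<Longrightarrow> b \<in> B \<Longrightarrow> a + b \<in> K"
  shows "emeasure lebesgue A + emeasure lebesgue B \<le> emeasure lebesgue K"
proof -
  let ?C = "\<lambda>S :: real set. {T. compact T \<and> T \<noteq> {} \<and> T \<subseteq> S}"
  have ne: "?C A \<noteq> {}" "?C B \<noteq> {}"
    using A(2) B(2) by (auto intro: exI[of _ "{_}"])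
  have "emeasure lebesgue S + emeasure lebesgue T \<le> emeasure lebesgue K"
    if "S \<in> ?C A" "T \<in> ?C B" for S T
    using that K by (intro emeasure_compact_sumset_ge) auto
  \<comment> \<open>The suprema are taken one after the other, first over the compact subsets of
    \<open>B\<close> with \<open>S\<close> fixed. A constant moves into a supremum only over a
    non-empty index set, hence \<open>ne\<close>.\<close>
  then have "emeasure lebesgue S + emeasure lebesgue B \<le> emeasure lebesgue K" if "S \<in> ?C A" for S
    using that ne(2) unfolding emeasure_lebesgue_inner_compact[OF B]
    by (subst ennreal_SUP_add_right) (auto intro!: SUP_least)
  then show ?thesis
    using ne(1) unfolding emeasure_lebesgue_inner_compact[OF A]
    by (subst ennreal_SUP_add_left[symmetric]) (auto intro!: SUP_least)
qed

text \<open>Length is homogeneous of degree one, so this is the sumset inequality for the dilates of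
  \<open>A\<close> by \<open>1 - t\<close> and of \<open>B\<close> by \<open>t\<close>.\<close>

lemma brunn_minkowski_real:
  fixes A B K :: "real set"
  assumes t: "0 < t" "t < 1"
    and A: "A \<in> sets lebesgue" "A \<noteq> {}" and B: "B \<in> sets lebesgue" "B \<noteq> {}"
    and K: "K \<in> sets lebesgue" "\<And>a b. a \<in> A \<Longrightarrow> b \<in> B \<Longrightarrow> (1 - t) * a + t * b \<in> K"
  shows "ennreal (1 - t) * emeasure lebesgue A + ennreal t * emeasure lebesgue B \<le> emeasure lebesgue K"
proof -
  have scale: "(*) c ` S \<in> sets lebesgue \<and> emeasure lebesgue ((*) c ` S) = ennreal c * emeasure lebesgue S"
    if "S \<in> sets lebesgue" "0 < c" for S :: "real set" and c :: real
  proof -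
    \<comment> \<open>Written as a preimage under the inverse scaling, the dilate is seen to be
      Lebesgue measurable.\<close>
    have "(*) c ` S = (\<lambda>x. (1 / c) *\<^sub>R x) -` S \<inter> space lebesgue"
      using that by (auto simp: image_iff field_simps) 
        (metis mult.commute nonzero_mult_div_cancel_left less_irrefl times_divide_eq_right)
    moreover have "(\<lambda>x. (1 / c) *\<^sub>R x) -` S \<inter> space lebesgue \<in> sets lebesgue"
      using that by (intro measurable_sets[OF lebesgue_measurable_scaling])
    ultimately show ?thesis
      using that emeasure_lebesgue_affine[of c 0 S] by simp
  qed
  have "emeasure lebesgue ((*) (1 - t) ` A) + emeasure lebesgue ((*) t ` B) \<le> emeasure lebesgue K"
    using assms scale by (intro emeasure_sumset_ge) auto
  then show ?thesis using assms scale by (simp del: emeasure_completion)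
qed

section \<open>The layer-cake formula\<close>

lemma sigma_finite_lebesgue: "sigma_finite_measure (lebesgue :: 'a::euclidean_space measure)"
proof
  obtain A :: "'a set set" where "countable A" "A \<subseteq> sets lborel" "\<Union>A = space lborel"
      "\<forall>a\<in>A. emeasure lborel a \<noteq> \<infinity>"
    using lborel.sigma_finite_countable by auto
  then show "\<exists>A :: 'a set set. countable A \<and> A \<subseteq> sets lebesgue \<and> \<Union>A = space lebesgue \<and>
      (\<forall>a\<in>A. emeasure lebesgue a \<noteq> \<infinity>)"
    by (intro exI[of _ A]) (auto simp: subset_iff)
qed

text \<open>The set is the half-open interval from \<open>0\<close> to \<open>y\<close>, which for
  infinite \<open>y\<close> is a half-line and contains intervals of every length
  \<open>n\<close>.\<close>

lemma nn_integral_indicator_below: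
  "(\<integral>\<^sup>+ s. indicator {s. 0 \<le> s \<and> ennreal s < y} s \<partial>lborel) = y"
proof (cases y)
  case (real r)
  then have "{s. 0 \<le> s \<and> ennreal s < y} = {0..<r}"
    by (auto simp: ennreal_less_iff)
  then show ?thesis using real by simp
next
  case top
  have "of_nat n \<le> emeasure lborel {0::real..}" for n
  proof -
    have "emeasure lborel {0..real n} \<le> emeasure lborel {0::real..}"
      by (intro emeasure_mono) auto
    then show ?thesis by (simp add: ennreal_of_nat_eq_real_of_nat)
  qed
  then have "emeasure lborel {0::real..} = top"
    using ennreal_Ex_less_of_nat leD less_top by metis
  then show ?thesis using top by (simp add: atLeast_def[symmetric])
qed

text \<open>The superlevel sets are the sections of one measurable set in the product space, the
  region below the graph of \<open>u\<close>.\<close>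

lemma (in sigma_finite_measure) borel_measurable_emeasure_superlevel:
  assumes [measurable]: "u \<in> borel_measurable M"
  shows "(\<lambda>s. emeasure M {x \<in> space M. ennreal s < u x}) \<in> borel_measurable borel"
proof (rule measurable_emeasure)
  have "{p \<in> space (borel \<Otimes>\<^sub>M M). ennreal (fst p) < u (snd p)} \<in> sets (borel \<Otimes>\<^sub>M M)"
    by measurable
  also have "{p \<in> space (borel \<Otimes>\<^sub>M M). ennreal (fst p) < u (snd p)} =
      {p \<in> space (borel \<Otimes>\<^sub>M M). snd p \<in> {x \<in> space M. ennreal (fst p) < u x}}"
    by (auto simp: space_pair_measure)
  finally show "{p \<in> space (borel \<Otimes>\<^sub>M M). snd p \<in> {x \<in> space M. ennreal (fst p) < u x}}
      \<in> sets (borel \<Otimes>\<^sub>M M)" .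
qed auto

text \<open>Tonelli's theorem for the region below the graph. The factor
  \<open>indicator {0..} s\<close> discards negative \<open>s\<close>, which \<open>ennreal\<close>
  would send to \<open>0\<close>.\<close>

lemma (in sigma_finite_measure) nn_integral_layer_cake:
  assumes [measurable]: "u \<in> borel_measurable M"
  shows "(\<integral>\<^sup>+ x. u x \<partial>M)
    = (\<integral>\<^sup>+ s. indicator {0..} s * emeasure M {x \<in> space M. ennreal s < u x} \<partial>lborel)"
proof -
  interpret P: pair_sigma_finite M lborel ..
  have "(\<integral>\<^sup>+ x. u x \<partial>M)
      = (\<integral>\<^sup>+ x. (\<integral>\<^sup>+ s. indicator {0..} s * indicator {x \<in> space M. ennreal s < u x} x \<partial>lborel) \<partial>M)"
  proof (rule nn_integral_cong)
    fix x assume x: "x \<in> space M"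
    have "(\<integral>\<^sup>+ s. indicator {0..} s * indicator {x \<in> space M. ennreal s < u x} x \<partial>lborel)
        = (\<integral>\<^sup>+ s. indicator {s. 0 \<le> s \<and> ennreal s < u x} s \<partial>lborel)"
      using x by (intro nn_integral_cong) (auto simp: indicator_def)
    then show "u x = (\<integral>\<^sup>+ s. indicator {0..} s * indicator {x \<in> space M. ennreal s < u x} x \<partial>lborel)"
      by (simp add: nn_integral_indicator_below)
  qed
  also have "\<dots> = (\<integral>\<^sup>+ s. (\<integral>\<^sup>+ x. indicator {0..} s * indicator {x \<in> space M. ennreal s < u x} x \<partial>M) \<partial>lborel)"
    by (intro P.Fubini'[symmetric]) measurable
  also have "\<dots> = (\<integral>\<^sup>+ s. indicator {0..} s * emeasure M {x \<in> space M. ennreal s < u x} \<partial>lborel)"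
    by (intro nn_integral_cong) (simp add: nn_integral_cmult)
  finally show ?thesis .
qed

section \<open>The one-dimensional inequality for functions with equal suprema\<close>

text \<open>For positive \<open>s\<close> this is strict monotonicity of both powers, as the
  exponents add up to \<open>1\<close>. For \<open>s = 0\<close> both factors are positive.\<close>

lemma prod_powr_greater:
  fixes a b s t :: real
  assumes "0 < t" "t < 1" "0 \<le> s" "s < a" "s < b"
  shows "s < a powr (1 - t) * b powr t"
proof (cases "s = 0")
  case False
  have "s = s powr (1 - t) * s powr t"
    using False assms by (simp flip: powr_add)
  also have "\<dots> < a powr (1 - t) * b powr t"
    using False assms by (intro mult_strict_mono powr_less_mono2) auto
  finally show ?thesis .
qed (use assms in auto)

text \<open>The function \<open>k\<close> is any measurable majorant rather than the Asplund sum of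
  \<open>u\<close> and \<open>v\<close>: the restriction to a line of an Asplund sum in higher
  dimension also sees points off the line, so it only dominates the Asplund sum of the
  restrictions.\<close>

lemma nn_integral_asplund_real:
  fixes u v :: "real \<Rightarrow> real" and k :: "real \<Rightarrow> ennreal"
  assumes t: "0 < t" "t < 1"
    and [measurable]: "u \<in> borel_measurable lebesgue" "v \<in> borel_measurable lebesgue"
      "k \<in> borel_measurable lebesgue"
    and sup: "(SUP a. ennreal (u a)) = (SUP a. ennreal (v a))"
    and k: "\<And>a b. ennreal (u a powr (1 - t) * v b powr t) \<le> k ((1 - t) * a + t * b)"
  shows "ennreal (1 - t) * (\<integral>\<^sup>+ x. ennreal (u x) \<partial>lebesgue) + ennreal t * (\<integral>\<^sup>+ x. ennreal (v x) \<partial>lebesgue)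
    \<le> (\<integral>\<^sup>+ x. k x \<partial>lebesgue)"
proof -
  interpret L: sigma_finite_measure "lebesgue :: real measure"
    by (rule sigma_finite_lebesgue)
  let ?e = "\<lambda>w s. indicator {0..} s * emeasure lebesgue {x \<in> space lebesgue. ennreal s < w x}"
  note L.borel_measurable_emeasure_superlevel[measurable]
  have level: "ennreal (1 - t) * ?e (\<lambda>x. ennreal (u x)) s + ennreal t * ?e (\<lambda>x. ennreal (v x)) s \<le> ?e k s" for s
  proof (cases "0 \<le> s")
    case s: True
    let ?A = "{x \<in> space lebesgue. ennreal s < ennreal (u x)}"
    let ?B = "{x \<in> space lebesgue. ennreal s < ennreal (v x)}"
    let ?K = "{x \<in> space lebesgue. ennreal s < k x}"
    \<comment> \<open>A superlevel set is non-empty exactly when \<open>s\<close> is below the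
      supremum, attained or not. If just one of the sets were empty, Brunn-Minkowski could
      fail.\<close>
    have ne: "?A \<noteq> {} \<longleftrightarrow> ?B \<noteq> {}"
      using sup less_SUP_iff[of "ennreal s" "\<lambda>a. ennreal (u a)" UNIV]
        less_SUP_iff[of "ennreal s" "\<lambda>a. ennreal (v a)" UNIV] by auto
    have "ennreal (1 - t) * emeasure lebesgue ?A + ennreal t * emeasure lebesgue ?B \<le> emeasure lebesgue ?K"
    proof (cases "?A = {}")
      case True
      then have "?B = {}" using ne by blast
      with True show ?thesis by (simp only: emeasure_empty) simp
    next
      case False
      show ?thesis
      proof (rule brunn_minkowski_real[OF t])
        fix a b assume "a \<in> ?A" "b \<in> ?B"
        then have "s < u a powr (1 - t) * v b powr t"
          using s t by (intro prod_powr_greater) (auto simp: ennreal_less_iff)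
        then have "ennreal s < ennreal (u a powr (1 - t) * v b powr t)"
          using s by (simp add: ennreal_less_iff)
        also note k[of a b]
        finally show "(1 - t) * a + t * b \<in> ?K" by simp
      next
        show "?A \<in> sets lebesgue" "?B \<in> sets lebesgue" "?K \<in> sets lebesgue" by measurable
        show "?A \<noteq> {}" "?B \<noteq> {}" using False ne by blast+
      qed
    qed
    then show ?thesis using s by simp
  qed simp
  have "ennreal (1 - t) * (\<integral>\<^sup>+ x. ennreal (u x) \<partial>lebesgue) + ennreal t * (\<integral>\<^sup>+ x. ennreal (v x) \<partial>lebesgue)
    = (\<integral>\<^sup>+ s. ennreal (1 - t) * ?e (\<lambda>x. ennreal (u x)) s + ennreal t * ?e (\<lambda>x. ennreal (v x)) s \<partial>lborel)"
    by (simp add: L.nn_integral_layer_cake nn_integral_add nn_integral_cmult)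
  also have "\<dots> \<le> (\<integral>\<^sup>+ s. ?e k s \<partial>lborel)"
    by (intro nn_integral_mono level)
  also have "\<dots> = (\<integral>\<^sup>+ x. k x \<partial>lebesgue)"
    by (simp add: L.nn_integral_layer_cake)
  finally show ?thesis .
qed

section \<open>Fubini's theorem along the lines of a given direction\<close>

text \<open>Integrating over all lines parallel to \<open>\<nu>\<close> counts every line with the length of its
  intersection with the support of the weight, so the slab of width one gives Fubini's theorem for
  an arbitrary direction without a change of coordinates.\<close>

definition slab_measure :: "'a::euclidean_space \<Rightarrow> 'a measure" where
  "slab_measure \<nu> = density lborel (indicator {x. 0 \<le> x \<bullet> \<nu> \<and> x \<bullet> \<nu> < 1})"

lemma sets_slab_measure [simp, measurable_cong]: "sets (slab_measure \<nu>) = sets borel"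
  by (simp add: slab_measure_def)

lemma nn_integral_lborel_shift:
  fixes F :: "'a::euclidean_space \<Rightarrow> ennreal"
  assumes [measurable]: "F \<in> borel_measurable borel"
  shows "(\<integral>\<^sup>+ x. F (x + c) \<partial>lborel) = (\<integral>\<^sup>+ x. F x \<partial>lborel)"
  by (subst lborel_distr_plus[of c, symmetric]) (simp add: nn_integral_distr add.commute)

text \<open>The weight \<open>w\<close> integrates to one along each line parallel to \<nu>, so it
  can be inserted for free. After an exchange of the integrals, a translation moves the shift from
  \<open>w\<close> to \<open>F\<close>.\<close>

lemma nn_integral_slices_borel:
  fixes F :: "'a::euclidean_space \<Rightarrow> ennreal"
  assumes \<nu>: "norm \<nu> = 1" and [measurable]: "F \<in> borel_measurable borel"
  shows "(\<integral>\<^sup>+ x. F x \<partial>lborel) = (\<integral>\<^sup>+ x. (\<integral>\<^sup>+ s. F (x + s *\<^sub>R \<nu>) \<partial>lborel) \<partial>slab_measure \<nu>)"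
proof -
  define w :: "'a \<Rightarrow> ennreal" where "w = indicator {x. 0 \<le> x \<bullet> \<nu> \<and> x \<bullet> \<nu> < 1}"
  have [measurable]: "w \<in> borel_measurable borel" unfolding w_def by measurable
  have \<nu>\<nu>: "\<nu> \<bullet> \<nu> = 1" using \<nu> by (simp add: norm_eq_1)
  have w: "(\<integral>\<^sup>+ s. w (x + (- s) *\<^sub>R \<nu>) \<partial>lborel) = 1" for x
  proof -
    \<comment> \<open>The inner product with the unit vector \<nu> changes at unit speed along the
      line, so the slab cuts out an interval of length one.\<close>
    have "w (x + (- s) *\<^sub>R \<nu>) = indicator {x \<bullet> \<nu> - 1 <.. x \<bullet> \<nu>} s" for s
      using \<nu>\<nu> by (auto simp: w_def indicator_def inner_diff_left)
    then show ?thesis by simp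
  qed
  have "(\<integral>\<^sup>+ x. F x \<partial>lborel) = (\<integral>\<^sup>+ x. (\<integral>\<^sup>+ s. w (x + (- s) *\<^sub>R \<nu>) * F x \<partial>lborel) \<partial>lborel)"
  proof (rule nn_integral_cong)
    fix x
    have "(\<integral>\<^sup>+ s. w (x + (- s) *\<^sub>R \<nu>) * F x \<partial>lborel) = (\<integral>\<^sup>+ s. w (x + (- s) *\<^sub>R \<nu>) \<partial>lborel) * F x"
      by (rule nn_integral_multc) measurable
    then show "F x = (\<integral>\<^sup>+ s. w (x + (- s) *\<^sub>R \<nu>) * F x \<partial>lborel)"
      by (simp only: w mult_1)
  qed
  also have "\<dots> = (\<integral>\<^sup>+ s. (\<integral>\<^sup>+ x. w (x + (- s) *\<^sub>R \<nu>) * F x \<partial>lborel) \<partial>lborel)"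
    by (intro lborel_pair.Fubini'[symmetric]) measurable
  also have "\<dots> = (\<integral>\<^sup>+ s. (\<integral>\<^sup>+ x. w x * F (x + s *\<^sub>R \<nu>) \<partial>lborel) \<partial>lborel)"
  proof (rule nn_integral_cong)
    fix s :: real
    show "(\<integral>\<^sup>+ x. w (x + (- s) *\<^sub>R \<nu>) * F x \<partial>lborel) = (\<integral>\<^sup>+ x. w x * F (x + s *\<^sub>R \<nu>) \<partial>lborel)"
      by (subst nn_integral_lborel_shift[of _ "s *\<^sub>R \<nu>", symmetric]) (auto simp: algebra_simps)
  qed
  also have "\<dots> = (\<integral>\<^sup>+ x. (\<integral>\<^sup>+ s. w x * F (x + s *\<^sub>R \<nu>) \<partial>lborel) \<partial>lborel)"
    by (intro lborel_pair.Fubini') measurable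
  also have "\<dots> = (\<integral>\<^sup>+ x. w x * (\<integral>\<^sup>+ s. F (x + s *\<^sub>R \<nu>) \<partial>lborel) \<partial>lborel)"
    by (intro nn_integral_cong nn_integral_cmult) measurable
  also have "\<dots> = (\<integral>\<^sup>+ x. (\<integral>\<^sup>+ s. F (x + s *\<^sub>R \<nu>) \<partial>lborel) \<partial>slab_measure \<nu>)"
    unfolding slab_measure_def w_def[symmetric] by (subst nn_integral_density) auto
  finally show ?thesis .
qed

text \<open>The slicing formula is applied to a Borel null set \<open>N\<close> containing the
  exceptions. A non-negative function with integral zero vanishes almost everywhere; this is used
  once across the lines and once on each line.\<close>

lemma AE_slices:
  fixes P :: "'a::euclidean_space \<Rightarrow> bool"
  assumes \<nu>: "norm \<nu> = 1" and P: "AE x in lborel. P x"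
  shows "AE x in slab_measure \<nu>. AE s in lborel. P (x + s *\<^sub>R \<nu>)"
proof -
  obtain N where N: "{x. \<not> P x} \<subseteq> N" "emeasure lborel N = 0" and [measurable]: "N \<in> sets borel"
    using P by (auto elim!: AE_E)
  have "(\<integral>\<^sup>+ x. (\<integral>\<^sup>+ s. indicator N (x + s *\<^sub>R \<nu>) \<partial>lborel) \<partial>slab_measure \<nu>) = 0"
    using nn_integral_slices_borel[OF \<nu>, of "indicator N"] N by simp
  then have "AE x in slab_measure \<nu>. (\<integral>\<^sup>+ s. indicator N (x + s *\<^sub>R \<nu>) \<partial>lborel) = 0"
    by (subst (asm) nn_integral_0_iff_AE) measurable
  then show ?thesis
  proof eventually_elim
    case (elim x)
    then have "AE s in lborel. indicator N (x + s *\<^sub>R \<nu>) = (0 :: ennreal)"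
      by (subst (asm) nn_integral_0_iff_AE) measurable
    then show ?case
      by eventually_elim (use N(1) in \<open>auto simp: indicator_def split: if_splits\<close>)
  qed
qed

text \<open>Preimages under \<open>u\<close> and \<open>u'\<close> differ by a null set, and
  Lebesgue measure is complete.\<close>

lemma borel_measurable_lebesgue_AE_eq:
  fixes u u' :: "'a::euclidean_space \<Rightarrow> 'b::topological_space"
  assumes u': "u' \<in> borel_measurable borel" and eq: "AE x in lborel. u x = u' x"
  shows "u \<in> borel_measurable lebesgue"
proof (rule measurableI)
  fix S :: "'b set" assume S: "S \<in> sets borel"
  have "u' \<in> borel_measurable lebesgue" using u' by (simp add: measurable_completion)
  then have 1: "u' -` S \<inter> space lebesgue \<in> sets lebesgue" using S by (rule measurable_sets)
  have "AE x in lebesgue. x \<in> u' -` S \<inter> space lebesgue \<longleftrightarrow> x \<in> u -` S \<inter> space lebesgue"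
    using AE_completion[OF eq] by eventually_elim auto
  then show "u -` S \<inter> space lebesgue \<in> sets lebesgue"
    by (rule completion.in_sets_AE) (use 1 in auto)
qed simp

text \<open>A Lebesgue measurable function is measurable on almost every line only. Hence \<Phi> is
  built from a Borel function equal to \<open>F\<close> almost everywhere, which makes it Borel and
  lets it be integrated over the lines.\<close>

lemma lebesgue_slices:
  fixes F :: "'a::euclidean_space \<Rightarrow> ennreal"
  assumes \<nu>: "norm \<nu> = 1" and F: "F \<in> borel_measurable lebesgue"
  obtains \<Phi> where "\<Phi> \<in> borel_measurable borel"
    and "(\<integral>\<^sup>+ x. F x \<partial>lebesgue) = (\<integral>\<^sup>+ x. \<Phi> x \<partial>slab_measure \<nu>)"
    and "AE x in slab_measure \<nu>. (\<lambda>s. F (x + s *\<^sub>R \<nu>)) \<in> borel_measurable lebesgue \<and>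
           \<Phi> x = (\<integral>\<^sup>+ s. F (x + s *\<^sub>R \<nu>) \<partial>lebesgue)"
proof -
  obtain F' where F' [measurable]: "F' \<in> borel_measurable borel" and eq: "AE x in lborel. F x = F' x"
    using completion_ex_borel_measurable[OF F] by auto
  show ?thesis
  proof (rule that[of "\<lambda>x. \<integral>\<^sup>+ s. F' (x + s *\<^sub>R \<nu>) \<partial>lborel"])
    have "(\<integral>\<^sup>+ x. F x \<partial>lebesgue) = (\<integral>\<^sup>+ x. F' x \<partial>lborel)"
      unfolding nn_integral_completion using eq by (rule nn_integral_cong_AE)
    then show "(\<integral>\<^sup>+ x. F x \<partial>lebesgue) = (\<integral>\<^sup>+ x. (\<integral>\<^sup>+ s. F' (x + s *\<^sub>R \<nu>) \<partial>lborel) \<partial>slab_measure \<nu>)"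
      by (simp add: nn_integral_slices_borel[OF \<nu>])
    show "AE x in slab_measure \<nu>. (\<lambda>s. F (x + s *\<^sub>R \<nu>)) \<in> borel_measurable lebesgue \<and>
           (\<integral>\<^sup>+ s. F' (x + s *\<^sub>R \<nu>) \<partial>lborel) = (\<integral>\<^sup>+ s. F (x + s *\<^sub>R \<nu>) \<partial>lebesgue)"
      using AE_slices[OF \<nu> eq]
    proof eventually_elim
      case (elim x)
      have "(\<lambda>s. F (x + s *\<^sub>R \<nu>)) \<in> borel_measurable lebesgue"
        by (rule borel_measurable_lebesgue_AE_eq[OF _ elim]) measurable
      moreover have "(\<integral>\<^sup>+ s. F' (x + s *\<^sub>R \<nu>) \<partial>lborel) = (\<integral>\<^sup>+ s. F (x + s *\<^sub>R \<nu>) \<partial>lborel)"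
        by (rule nn_integral_cong_AE) (use elim in eventually_elim, simp)
      ultimately show ?case by (simp add: nn_integral_completion)
    qed
  qed measurable
qed

section \<open>Projections as suprema along normal lines\<close>

lemma hyperplane_eq_orthogonal:
  fixes H :: "(real ^ 'n) set"
  assumes "H \<in> linear_hyperplanes" "is_unit_normal \<nu> H"
  shows "H = {x. \<nu> \<bullet> x = 0}"
proof -
  have H: "subspace H" "dim H + 1 = DIM(real ^ 'n)"
    using assms(1) by (auto simp: linear_hyperplanes_def)
  have "\<nu> \<noteq> 0" and sub: "H \<subseteq> {x. \<nu> \<bullet> x = 0}"
    using assms(2) by (auto simp: is_unit_normal_def orthogonal_def)
  then show ?thesis
    using subspace_dim_equal[OF H(1) subspace_hyperplane sub] dim_hyperplane[of \<nu>] H(2) by simp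
qed

text \<open>The line through \<open>x\<close> meets \<open>H\<close> in the orthogonal projection of
  \<open>x\<close>, and a change of base point only shifts the parameter. This carries the equality
  of projections from \<open>H\<close> to lines with arbitrary base point, as integration over the
  slab requires.\<close>

lemma SUP_line_eq_proj_fun:
  fixes H :: "(real ^ 'n) set"
  assumes "H \<in> linear_hyperplanes" "is_unit_normal \<nu> H"
  shows "(SUP s::real. F (x + s *\<^sub>R \<nu>)) = proj_fun H F (x - (\<nu> \<bullet> x) *\<^sub>R \<nu>)"
proof -
  have "\<nu> \<bullet> \<nu> = 1" using assms(2) by (simp add: is_unit_normal_def norm_eq_1)
  then have "x - (\<nu> \<bullet> x) *\<^sub>R \<nu> \<in> H"
    by (simp add: hyperplane_eq_orthogonal[OF assms] inner_diff_right)
  then have "proj_fun H F (x - (\<nu> \<bullet> x) *\<^sub>R \<nu>) = (SUP s::real. F (x - (\<nu> \<bullet> x) *\<^sub>R \<nu> + s *\<^sub>R \<nu>))"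
    by (rule proj_fun_eq[OF assms])
  also have "\<dots> = (SUP s\<in>range (\<lambda>s. s + \<nu> \<bullet> x). F (x - (\<nu> \<bullet> x) *\<^sub>R \<nu> + s *\<^sub>R \<nu>))"
    by (simp only: surj_plus_right)
  also have "\<dots> = (SUP s::real. F (x + s *\<^sub>R \<nu>))"
    unfolding image_image by (simp add: scaleR_add_left)
  finally show ?thesis by simp
qed

section \<open>Integration over the lines parallel to the normal\<close>

theorem theorem1p3:
  fixes f g :: "real ^ 'n \<Rightarrow> real" and t :: real
  assumes "0 < t" and "t < 1"
    and "\<And>x. 0 \<le> f x" and "\<And>x. 0 \<le> g x"
    and "f \<in> borel_measurable lebesgue" and "g \<in> borel_measurable lebesgue"
    and "asplund_sum t f g \<in> borel_measurable lebesgue"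
    and "\<exists>H \<in> linear_hyperplanes.
           proj_fun H (\<lambda>x. ennreal (f x)) = proj_fun H (\<lambda>x. ennreal (g x))"
  shows "(\<integral>\<^sup>+ x. asplund_sum t f g x \<partial>lebesgue)
           \<ge> ennreal (1 - t) * (\<integral>\<^sup>+ x. ennreal (f x) \<partial>lebesgue)
             + ennreal t * (\<integral>\<^sup>+ x. ennreal (g x) \<partial>lebesgue)"
proof -
  obtain H where H: "H \<in> linear_hyperplanes"
      "proj_fun H (\<lambda>x. ennreal (f x)) = proj_fun H (\<lambda>x. ennreal (g x))"
    using assms(8) by auto
  obtain \<nu> where \<nu>: "is_unit_normal \<nu> H" using ex_unit_normal[OF H(1)] by auto
  then have norm: "norm \<nu> = 1" by (simp add: is_unit_normal_def)
  let ?k = "asplund_sum t f g" and ?M = "slab_measure \<nu>"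
  have [measurable]: "(\<lambda>x. ennreal (f x)) \<in> borel_measurable lebesgue"
      "(\<lambda>x. ennreal (g x)) \<in> borel_measurable lebesgue"
    using assms(5,6) by measurable
  obtain \<Phi> where [measurable]: "\<Phi> \<in> borel_measurable borel"
    and \<Phi>: "(\<integral>\<^sup>+ x. ennreal (f x) \<partial>lebesgue) = (\<integral>\<^sup>+ x. \<Phi> x \<partial>?M)"
      "AE x in ?M. (\<lambda>s. ennreal (f (x + s *\<^sub>R \<nu>))) \<in> borel_measurable lebesgue \<and>
           \<Phi> x = (\<integral>\<^sup>+ s. ennreal (f (x + s *\<^sub>R \<nu>)) \<partial>lebesgue)"
    by (rule lebesgue_slices[OF norm, of "\<lambda>x. ennreal (f x)"]) auto
  obtain \<Gamma> where [measurable]: "\<Gamma> \<in> borel_measurable borel"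
    and \<Gamma>: "(\<integral>\<^sup>+ x. ennreal (g x) \<partial>lebesgue) = (\<integral>\<^sup>+ x. \<Gamma> x \<partial>?M)"
      "AE x in ?M. (\<lambda>s. ennreal (g (x + s *\<^sub>R \<nu>))) \<in> borel_measurable lebesgue \<and>
           \<Gamma> x = (\<integral>\<^sup>+ s. ennreal (g (x + s *\<^sub>R \<nu>)) \<partial>lebesgue)"
    by (rule lebesgue_slices[OF norm, of "\<lambda>x. ennreal (g x)"]) auto
  obtain \<Psi> where [measurable]: "\<Psi> \<in> borel_measurable borel"
    and \<Psi>: "(\<integral>\<^sup>+ x. ?k x \<partial>lebesgue) = (\<integral>\<^sup>+ x. \<Psi> x \<partial>?M)"
      "AE x in ?M. (\<lambda>s. ?k (x + s *\<^sub>R \<nu>)) \<in> borel_measurable lebesgue \<and>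
           \<Psi> x = (\<integral>\<^sup>+ s. ?k (x + s *\<^sub>R \<nu>) \<partial>lebesgue)"
    by (rule lebesgue_slices[OF norm assms(7)])
  have "AE x in ?M. ennreal (1 - t) * \<Phi> x + ennreal t * \<Gamma> x \<le> \<Psi> x"
    using \<Phi>(2) \<Gamma>(2) \<Psi>(2)
  proof eventually_elim
    case (elim x)
    \<comment> \<open>Since \<open>f\<close> and \<open>g\<close> are non-negative,
      \<open>enn2real\<close> recovers the real slices from the extended ones.\<close>
    have meas: "(\<lambda>s. f (x + s *\<^sub>R \<nu>)) \<in> borel_measurable lebesgue"
        "(\<lambda>s. g (x + s *\<^sub>R \<nu>)) \<in> borel_measurable lebesgue"
      using elim assms(3,4)
        measurable_compose[of "\<lambda>s. ennreal (f (x + s *\<^sub>R \<nu>))" lebesgue borel enn2real borel]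
        measurable_compose[of "\<lambda>s. ennreal (g (x + s *\<^sub>R \<nu>))" lebesgue borel enn2real borel]
      by simp_all
    have sup: "(SUP s. ennreal (f (x + s *\<^sub>R \<nu>))) = (SUP s. ennreal (g (x + s *\<^sub>R \<nu>)))"
      using SUP_line_eq_proj_fun[OF H(1) \<nu>, of "\<lambda>x. ennreal (f x)" x]
        SUP_line_eq_proj_fun[OF H(1) \<nu>, of "\<lambda>x. ennreal (g x)" x] H(2) by simp
    \<comment> \<open>Two points of the line combine to a point of the same line, with the
      parameters combined alike. Pairs off the line can only enlarge the supremum.\<close>
    have k: "ennreal (f (x + a *\<^sub>R \<nu>) powr (1 - t) * g (x + b *\<^sub>R \<nu>) powr t)
        \<le> ?k (x + ((1 - t) * a + t * b) *\<^sub>R \<nu>)" for a b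
    proof -
      have "(1 - t) *\<^sub>R (x + a *\<^sub>R \<nu>) + t *\<^sub>R (x + b *\<^sub>R \<nu>) = x + ((1 - t) * a + t * b) *\<^sub>R \<nu>"
        by (simp add: algebra_simps)
      then show ?thesis unfolding asplund_sum_def by (intro Sup_upper) blast
    qed
    show ?case
      using nn_integral_asplund_real[OF assms(1,2) meas _ sup k] elim by simp
  qed
  then have "(\<integral>\<^sup>+ x. ennreal (1 - t) * \<Phi> x + ennreal t * \<Gamma> x \<partial>?M) \<le> (\<integral>\<^sup>+ x. \<Psi> x \<partial>?M)"
    by (rule nn_integral_mono_AE)
  then show ?thesis
    unfolding \<Phi>(1) \<Gamma>(1) \<Psi>(1) by (simp add: nn_integral_add nn_integral_cmult)
qed

end
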